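(* Every $\mathbb H$-valued function $f(t,g)$ that is regular on $\mathscr U=\mathbb R_+\times\mathscr H^{n-1}$ satisfies $$\Big(\partial_t+\frac1{8(n-1)}\triangle_H\Big)f=0,\qquad \triangle_H:=-\sum_{j=1}^{4n-4}Y_j^2 .$$
   Context: Let $n\ge2$. $\mathbb H$ denotes the quaternions. The quaternionic Heisenberg group $\mathscr H^{n-1}$ is $\mathbb R^{4n-1}=\mathbb R^3\times\mathbb R^{4n-4}$, with elements $(\bm t,\bm y)$ and product $(\bm t,\bm y)\cdot(\bm t',\bm y')=(\bm t+\bm t'+B(\bm y,\bm y'),\bm y+\bm y')$, $B=(B_1,B_2,B_3)$, $B_\alpha(\bm y,\bm y')=2\sum_{l=0}^{n-2}\sum_{j,k=1}^4 b^\alpha_{kj}y_{4l+k}y'_{4l+j}$, where $b^1=\begin{pmatrix}0&1&0&0\\-1&0&0&0\\0&0&0&-1\\0&0&1&0\end{pmatrix}$, $b^2=\begin{pmatrix}0&0&1&0\\0&0&0&1\\-1&0&0&0\\0&-1&0&0\end{pmatrix}$, $b^3=\begin{pmatrix}0&0&0&1\\0&0&-1&0\\0&1&0&0\\-1&0&0&0\end{pmatrix}$. Left-invariant vector fields: $Y_{4l+j}=\partial_{y_{4l+j}}+2\sum_{\alpha=1}^3\sum_{k=1}^4 b^\alpha_{kj}y_{4l+k}\partial_{t_\alpha}$ ($l=0,\dots,n-2$, $j=1,\dots,4$). $\mathscr U=(0,\infty)\times\mathscr H^{n-1}$ with coordinates $(t,\bm t,\bm y)$. A $C^1$ function $f:\mathscr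 U\to\mathbb H$ is regular if $\overline Q_mf=0$ for $m=0,\dots,n-1$, where $\overline Q_0=\partial_t+\mathbf i\partial_{t_1}+\mathbf j\partial_{t_2}+\mathbf k\partial_{t_3}$ and $\overline Q_{l+1}=Y_{4l+1}+\mathbf iY_{4l+2}+\mathbf jY_{4l+3}+\mathbf kY_{4l+4}$, $l=0,\dots,n-2$. Equivalently, $f\circ\pi$ is a regular (Cauchy--Fueter in each quaternionic variable) function on $\{(q_1,q')\in\mathbb H^n:\operatorname{Re}q_1>|q'|^2\}$, where $\pi(q_1,q')=(q_1-|q'|^2,q')$; in particular regular functions are $C^\infty$. *)

theory Defs
  imports "HOL-Analysis.Analysis"
begin

section \<open>Quaternions\<close>

text \<open>The quaternion \<open>x\<^sub>1 + x\<^sub>2 i + x\<^sub>3 j + x\<^sub>4 k\<close> is the vector \<open>(x\<^sub>1, x\<^sub>2, x\<^sub>3, x\<^sub>4)\<close>, so that the topology and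
  the real vector space structure are those of \<open>real ^ 4\<close>.  Beware that \<open>*\<close> on \<open>real ^ 4\<close> is the
  componentwise product; the quaternionic product is \<open>qmult\<close>.\<close>

type_synonym quat = "real ^ 4"

definition qmult :: "quat \<Rightarrow> quat \<Rightarrow> quat" (infixl "\<otimes>\<^sub>q" 70) where
  "p \<otimes>\<^sub>q q = vector
     [p $ 1 * q $ 1 - p $ 2 * q $ 2 - p $ 3 * q $ 3 - p $ 4 * q $ 4,
      p $ 1 * q $ 2 + p $ 2 * q $ 1 + p $ 3 * q $ 4 - p $ 4 * q $ 3,
      p $ 1 * q $ 3 - p $ 2 * q $ 4 + p $ 3 * q $ 1 + p $ 4 * q $ 2,
      p $ 1 * q $ 4 + p $ 2 * q $ 3 - p $ 3 * q $ 2 + p $ 4 * q $ 1]"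

definition q1 :: quat where "q1 = vector [1, 0, 0, 0]"
definition qi :: quat where "qi = vector [0, 1, 0, 0]"
definition qj :: quat where "qj = vector [0, 0, 1, 0]"
definition qk :: quat where "qk = vector [0, 0, 0, 1]"

lemma vector4_nth [simp]:
  "(vector [a, b, c, d] :: 'a::zero ^ 4) $ 1 = a"
  "(vector [a, b, c, d] :: 'a::zero ^ 4) $ 2 = b"
  "(vector [a, b, c, d] :: 'a::zero ^ 4) $ 3 = c"
  "(vector [a, b, c, d] :: 'a::zero ^ 4) $ 4 = d"
  by (simp_all add: vector_def)

lemma quat_units:
  "q1 \<otimes>\<^sub>q q = q" "qi \<otimes>\<^sub>q qi = - q1" "qj \<otimes>\<^sub>q qj = - q1" "qk \<otimes>\<^sub>q qk = - q1"
  "qi \<otimes>\<^sub>q qj = qk" "qj \<otimes>\<^sub>q qk = qi" "qk \<otimes>\<^sub>q qi = qj"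
  "qj \<otimes>\<^sub>q qi = - qk" "qk \<otimes>\<^sub>q qj = - qi" "qi \<otimes>\<^sub>q qk = - qj"
  by (simp_all add: vec_eq_iff forall_4 qmult_def q1_def qi_def qj_def qk_def)


section \<open>The quaternionic Heisenberg group\<close>

text \<open>The index type \<open>'m\<close> has \<open>n - 1\<close> elements and labels the blocks \<open>l = 0, \<dots>, n - 2\<close>: the real
  coordinate \<open>y\<^bsub>4l+k\<^esub>\<close> is \<open>y $ l $ k\<close>, with \<open>k = 1, \<dots>, 4\<close>.\<close>

type_synonym 'm heis = "(real ^ 3) \<times> (quat ^ 'm)"

text \<open>\<open>bmat $ \<alpha> $ k $ j\<close> is the entry of the matrix \<open>b\<^sup>\<alpha>\<close> in row \<open>k\<close> and column \<open>j\<close>.\<close>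

definition bmat :: "real ^ 4 ^ 4 ^ 3" where
  "bmat = vector
    [vector [vector [ 0,  1,  0,  0],
             vector [-1,  0,  0,  0],
             vector [ 0,  0,  0, -1],
             vector [ 0,  0,  1,  0]],
     vector [vector [ 0,  0,  1,  0],
             vector [ 0,  0,  0,  1],
             vector [-1,  0,  0,  0],
             vector [ 0, -1,  0,  0]],
     vector [vector [ 0,  0,  0,  1],
             vector [ 0,  0, -1,  0],
             vector [ 0,  1,  0,  0],
             vector [-1,  0,  0,  0]]]"

definition heis_B :: "quat ^ 'm::finite \<Rightarrow> quat ^ 'm \<Rightarrow> real ^ 3" where
  "heis_B y y' = (\<chi> \<alpha>. 2 * (\<Sum>l\<in>UNIV. \<Sum>j\<in>UNIV. \<Sum>k\<in>UNIV. bmat $ \<alpha> $ k $ j * y $ l $ k * y' $ l $ j))"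

fun heis_mult :: "'m::finite heis \<Rightarrow> 'm heis \<Rightarrow> 'm heis" where
  "heis_mult (t, y) (t', y') = (t + t' + heis_B y y', y + y')"


section \<open>Functions on the half space over the group\<close>

text \<open>Functions on the half space are total functions, of which only the values on the open set
  \<open>upper_half\<close> matter.\<close>

definition upper_half :: "(real \<times> 'm::finite heis) set" where
  "upper_half = {0<..} \<times> UNIV"

definition dir_deriv ::
    "'a::real_normed_vector \<Rightarrow> ('a \<Rightarrow> 'b::real_normed_vector) \<Rightarrow> 'a \<Rightarrow> 'b" where
  "dir_deriv v f p = vector_derivative (\<lambda>s::real. f (p + s *\<^sub>R v)) (at 0)"

definition d_t :: "(real \<times> 'm::finite heis \<Rightarrow> quat) \<Rightarrow> real \<times> 'm heis \<Rightarrow> quat" where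
  "d_t = dir_deriv (1, 0, 0)"

definition d_tvec :: "3 \<Rightarrow> (real \<times> 'm::finite heis \<Rightarrow> quat) \<Rightarrow> real \<times> 'm heis \<Rightarrow> quat" where
  "d_tvec \<alpha> = dir_deriv (0, axis \<alpha> 1, 0)"

definition d_y :: "'m::finite \<Rightarrow> 4 \<Rightarrow> (real \<times> 'm heis \<Rightarrow> quat) \<Rightarrow> real \<times> 'm heis \<Rightarrow> quat" where
  "d_y l j = dir_deriv (0, 0, axis l (axis j 1))"

text \<open>\<open>Yfield l j\<close> is the vector field \<open>Y\<^bsub>4l+j\<^esub>\<close>.\<close>

definition Yfield :: "'m::finite \<Rightarrow> 4 \<Rightarrow> (real \<times> 'm heis \<Rightarrow> quat) \<Rightarrow> real \<times> 'm heis \<Rightarrow> quat" where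
  "Yfield l j f = (\<lambda>(t, tv, y). d_y l j f (t, tv, y) +
     2 *\<^sub>R (\<Sum>\<alpha>\<in>UNIV. \<Sum>k\<in>UNIV. (bmat $ \<alpha> $ k $ j * y $ l $ k) *\<^sub>R d_tvec \<alpha> f (t, tv, y)))"

text \<open>The fields \<open>Yfield l j\<close> are left invariant: at \<open>g\<close> they differentiate along \<open>s \<mapsto> g \<cdot> (0, s e\<^bsub>4l+j\<^esub>)\<close>.\<close>

lemma heis_mult_one_parameter:
  "heis_mult (tv, y) (0, s *\<^sub>R axis l (axis j 1)) =
     (tv, y) + s *\<^sub>R (2 *\<^sub>R (\<Sum>\<alpha>\<in>UNIV. \<Sum>k\<in>UNIV. (bmat $ \<alpha> $ k $ j * y $ l $ k) *\<^sub>R axis \<alpha> 1),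
                     axis l (axis j 1))"
proof -
  have A: "(s *\<^sub>R axis l (axis j (1::real))) $ l' $ j' = (if l' = l then if j' = j then s else 0 else 0)"
    for l' :: 'a and j' :: 4
    by (simp add: axis_def)
  have B: "(\<Sum>l'\<in>UNIV. \<Sum>j'\<in>UNIV. \<Sum>k\<in>UNIV. bmat $ \<alpha> $ k $ j' * y $ l' $ k *
      (if l' = l then if j' = j then s else 0 else 0)) = (\<Sum>k\<in>UNIV. bmat $ \<alpha> $ k $ j * y $ l $ k * s)"
    for \<alpha>
  proof -
    have "(\<Sum>k\<in>UNIV. bmat $ \<alpha> $ k $ j' * y $ l' $ k * (if l' = l then if j' = j then s else 0 else 0)) =
        (if j' = j then if l' = l then \<Sum>k\<in>UNIV. bmat $ \<alpha> $ k $ j * y $ l $ k * s else 0 else 0)" for l' j'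
      by simp
    then show ?thesis by (simp only: sum.delta finite UNIV_I if_True)
  qed
  have "heis_B y (s *\<^sub>R axis l (axis j 1)) =
      s *\<^sub>R 2 *\<^sub>R (\<Sum>\<alpha>\<in>UNIV. \<Sum>k\<in>UNIV. (bmat $ \<alpha> $ k $ j * y $ l $ k) *\<^sub>R axis \<alpha> 1)"
    unfolding heis_B_def A B
    by (simp add: vec_eq_iff forall_3 sum_3 sum_4 axis_def algebra_simps)
  then show ?thesis by simp
qed

definition Qbar0 :: "(real \<times> 'm::finite heis \<Rightarrow> quat) \<Rightarrow> real \<times> 'm heis \<Rightarrow> quat" where
  "Qbar0 f p = d_t f p + qi \<otimes>\<^sub>q d_tvec 1 f p + qj \<otimes>\<^sub>q d_tvec 2 f p + qk \<otimes>\<^sub>q d_tvec 3 f p"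

text \<open>\<open>Qbar l\<close> is the operator with subscript \<open>l + 1\<close>, attached to the block \<open>l\<close>.\<close>

definition Qbar :: "'m::finite \<Rightarrow> (real \<times> 'm heis \<Rightarrow> quat) \<Rightarrow> real \<times> 'm heis \<Rightarrow> quat" where
  "Qbar l f p =
     Yfield l 1 f p + qi \<otimes>\<^sub>q Yfield l 2 f p + qj \<otimes>\<^sub>q Yfield l 3 f p + qk \<otimes>\<^sub>q Yfield l 4 f p"

definition C1_on :: "('a::real_normed_vector \<Rightarrow> 'b::real_normed_vector) \<Rightarrow> 'a set \<Rightarrow> bool" where
  "C1_on f S \<longleftrightarrow> (\<exists>f' :: 'a \<Rightarrow> 'a \<Rightarrow>\<^sub>L 'b.
     (\<forall>p\<in>S. (f has_derivative blinfun_apply (f' p)) (at p)) \<and> continuous_on S f')"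

definition regular :: "(real \<times> 'm::finite heis \<Rightarrow> quat) \<Rightarrow> bool" where
  "regular f \<longleftrightarrow> C1_on f upper_half \<and>
     (\<forall>p\<in>upper_half. Qbar0 f p = 0 \<and> (\<forall>l. Qbar l f p = 0))"

definition sub_Laplacian :: "(real \<times> 'm::finite heis \<Rightarrow> quat) \<Rightarrow> real \<times> 'm heis \<Rightarrow> quat" where
  "sub_Laplacian f p = - (\<Sum>l\<in>UNIV. \<Sum>j\<in>UNIV. Yfield l j (Yfield l j f) p)"

end

theory Submission
  imports Defs
begin

text \<open>Multiplying \<open>Qbar l f = 0\<close> from the left by the conjugate operator gives
  \<open>\<Sum>\<^sub>j Y\<^sub>j\<^sup>2 f\<close> plus commutators; these are central and add up to
  \<open>8 (i \<partial>\<^bsub>t\<^sub>1\<^esub> + j \<partial>\<^bsub>t\<^sub>2\<^esub> + k \<partial>\<^bsub>t\<^sub>3\<^esub>) f = - 8 \<partial>\<^sub>t f\<close>.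

  As \<open>f\<close> is only assumed to be \<open>C\<^sup>1\<close>, the second derivatives have to be produced first. After the
  shear \<open>t \<mapsto> t - |y|\<^sup>2\<close> the function \<open>F\<close> is Cauchy--Fueter in every quaternionic variable. For the
  radial weight \<open>\<phi> z = (1 - |z|\<^sup>2)\<^sub>+\<^sup>3\<close>, the derivative of \<open>\<delta> \<mapsto> \<integral> \<phi> z F (x + \<delta> z) dz\<close> is
  \<open>\<integral> \<phi> z F' (x + \<delta> z) z dz\<close>, which vanishes by the Cauchy--Fueter equations and
  integration by parts. Hence \<open>F\<close> is a multiple of its own mollification, and differentiating the
  weight shows that \<open>F'\<close> is differentiable, with symmetric second derivative.\<close>

section \<open>Radial weights\<close>

definition bump :: "nat \<Rightarrow> 'a::euclidean_space \<Rightarrow> real" where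
  "bump k z = max 0 (1 - z \<bullet> z) ^ k"

text \<open>Only 0 is critical: there the difference quotient is \<open>max 0 h ^ Suc k\<close>,
  still a positive power, because the exponent is at least 2.\<close>

lemma DERIV_max_0_power:
  "((\<lambda>s::real. max 0 s ^ Suc (Suc k)) has_real_derivative real (k + 2) * max 0 s ^ Suc k) (at s)"
proof -
  consider "s < 0" | "s > 0" | "s = 0" by linarith
  then show ?thesis
  proof cases
    case 1
    have "((\<lambda>s::real. 0) has_real_derivative real (k + 2) * max 0 s ^ Suc k) (at s)"
      using 1 by (auto intro!: derivative_eq_intros)
    then show ?thesis
      by (rule has_field_derivative_transform_within_open[where S = "{..<0}"]) (use 1 in auto)
  next
    case 2
    have "((\<lambda>s::real. s ^ Suc (Suc k)) has_real_derivative real (k + 2) * max 0 s ^ Suc k) (at s)"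
      using DERIV_pow[of "Suc (Suc k)" s] 2 by (simp add: max_def add.commute)
    then show ?thesis
      by (rule has_field_derivative_transform_within_open[where S = "{0<..}"]) (use 2 in auto)
  next
    case 3
    have "((\<lambda>h::real. max 0 h ^ Suc k) \<longlongrightarrow> max 0 0 ^ Suc k) (at 0)"
      by (intro tendsto_intros)
    then have "((\<lambda>h::real. max 0 h ^ Suc k) \<longlongrightarrow> 0) (at 0)"
      by simp
    then have "((\<lambda>h::real. max 0 h ^ Suc (Suc k) / h) \<longlongrightarrow> 0) (at 0)"
      by (rule Lim_transform_eventually)
         (auto simp: eventually_at_filter max_def)
    then show ?thesis
      using 3 by (simp add: DERIV_def)
  qed
qed

text \<open>The gradient at \<open>z\<close> is a multiple of \<open>z\<close>, and the exponent
  falls by one. Starting from exponent 3, one differentiation leaves exponent 2, so that the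
  resulting weight is again continuously differentiable.\<close>

lemma bump_has_derivative:
  "(bump (Suc (Suc k)) has_derivative
     blinfun_apply ((- 2 * real (k + 2) * bump (Suc k) z) *\<^sub>R blinfun_inner_right z)) (at z)"
proof -
  have "((\<lambda>z::'a. 1 - z \<bullet> z) has_derivative (\<lambda>v. - (z \<bullet> v + v \<bullet> z))) (at z)"
    by (auto intro!: derivative_eq_intros simp: fun_eq_iff)
  from has_derivative_compose[OF this, of "\<lambda>s. max 0 s ^ Suc (Suc k)"]
    DERIV_max_0_power[of k "1 - z \<bullet> z"]
  have "((\<lambda>z. max 0 (1 - z \<bullet> z) ^ Suc (Suc k)) has_derivative
      (\<lambda>v. real (k + 2) * max 0 (1 - z \<bullet> z) ^ Suc k * - (z \<bullet> v + v \<bullet> z))) (at z)"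
    unfolding has_field_derivative_def by blast
  moreover have "bump (Suc (Suc k)) = (\<lambda>z::'a. max 0 (1 - z \<bullet> z) ^ Suc (Suc k))"
    by (simp add: bump_def fun_eq_iff)
  moreover have "(\<lambda>v. real (k + 2) * max 0 (1 - z \<bullet> z) ^ Suc k * - (z \<bullet> v + v \<bullet> z)) =
     blinfun_apply ((- 2 * real (k + 2) * bump (Suc k) z) *\<^sub>R blinfun_inner_right z)"
    by (simp add: bump_def fun_eq_iff blinfun.bilinear_simps blinfun_inner_right.rep_eq inner_commute algebra_simps)
  ultimately show ?thesis by metis
qed

lemma continuous_on_bump [continuous_intros]: "continuous_on S (bump k)"
  unfolding bump_def by (intro continuous_intros)

section \<open>Cubes as domains of integration\<close>

text \<open>Boxes take the place of balls because the Leibniz rule works on \<open>cbox\<close>.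
  Three radii recur: weights are supported in \<open>cube 1\<close>, integrals run over
  \<open>cube 2\<close>, and the functions are controlled on \<open>cube 3\<close>, which leaves
  room for translations by vectors of \<open>cube 1\<close>.\<close>

definition cube :: "real \<Rightarrow> 'a::euclidean_space set" where
  "cube r = cbox (- (r *\<^sub>R One)) (r *\<^sub>R One)"

lemma mem_cube: "z \<in> cube r \<longleftrightarrow> (\<forall>b\<in>Basis. \<bar>z \<bullet> b\<bar> \<le> r)"
  by (auto simp: cube_def mem_box abs_le_iff)

lemma cube_add: "z \<in> cube r \<Longrightarrow> w \<in> cube s \<Longrightarrow> z + w \<in> cube (r + s)"
  unfolding mem_cube by (auto simp: inner_add_left intro!: order_trans[OF abs_triangle_ineq] add_mono)

lemma cube_mono: "r \<le> s \<Longrightarrow> cube r \<subseteq> cube s"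
  by (force simp: mem_cube)

lemma norm_le_imp_mem_cube: "norm z \<le> r \<Longrightarrow> z \<in> cube r"
  unfolding mem_cube using Basis_le_norm order_trans by blast

lemma norm_le_of_mem_cube:
  fixes z :: "'a::euclidean_space"
  assumes "z \<in> cube r" shows "norm z \<le> r * DIM('a)"
proof -
  have "norm z \<le> (\<Sum>b\<in>Basis. \<bar>z \<bullet> b\<bar>)" by (rule norm_le_l1)
  also have "\<dots> \<le> (\<Sum>b\<in>(Basis::'a set). r)" using assms by (intro sum_mono) (auto simp: mem_cube)
  finally show ?thesis by (simp add: mult.commute)
qed

text \<open>The exponent has to be positive, since \<open>bump 0\<close> is constantly 1.\<close>

lemma bump_eq_0: "z \<notin> cube 1 \<Longrightarrow> bump (Suc k) z = 0"
proof -
  assume "z \<notin> cube 1"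
  then have "norm z > 1" using norm_le_imp_mem_cube[of z 1] by force
  then have "z \<bullet> z > 1" by (simp add: dot_square_norm power2_eq_square less_1_mult)
  then show ?thesis by (simp add: bump_def)
qed

text \<open>Before and after the translation the support lies in \<open>cube 2\<close>, so both
  integrals are integrals over the whole space, where translation changes nothing.\<close>

lemma has_integral_shift_support:
  fixes g :: "'a::euclidean_space \<Rightarrow> 'b::banach"
  assumes "(g has_integral I) (cube 2)" and "\<And>z. z \<notin> cube 1 \<Longrightarrow> g z = 0" and "w \<in> cube 1"
  shows "((\<lambda>z. g (z - w)) has_integral I) (cube 2)"
proof -
  have "((\<lambda>z. g (z - w)) has_integral I) (cbox (- (2 *\<^sub>R One) + w) (2 *\<^sub>R One + w))"
    using has_integral_shift_cbox[OF assms(1)[unfolded cube_def], of "-w"] by (simp add: algebra_simps)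
  then have U: "((\<lambda>z. g (z - w)) has_integral I) UNIV"
  proof (rule has_integral_on_superset)
    fix z assume "z \<notin> cbox (- (2 *\<^sub>R One) + w) (2 *\<^sub>R One + w)"
    then have "z - w \<notin> cube 2" by (auto simp: cube_def mem_box algebra_simps)
    then have "z - w \<notin> cube 1" using cube_mono[of 1 2] by auto
    then show "g (z - w) = 0" by (rule assms(2))
  qed auto
  have "(\<lambda>z. if z \<in> cube 2 then g (z - w) else 0) = (\<lambda>z. g (z - w))"
  proof
    fix z
    have "g (z - w) = 0" if "z \<notin> cube 2"
      using cube_add[of "z - w" 1 w 1] that assms(2,3) by fastforce
    then show "(if z \<in> cube 2 then g (z - w) else 0) = g (z - w)" by simp
  qed
  then show ?thesis using U has_integral_restrict_UNIV[of "cube 2" "\<lambda>z. g (z - w)" I] by simp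
qed

section \<open>Integration by parts against a compactly supported weight\<close>

text \<open>By translation invariance the integrals of
  \<open>\<psi> z *\<^sub>R u (z + s *\<^sub>R a)\<close> and of
  \<open>\<psi> (z - s *\<^sub>R a) *\<^sub>R u z\<close> agree for small \<open>s\<close>.
  Differentiating both under the integral sign at \<open>s = 0\<close> gives the two sides; no
  boundary terms and no iterated integrals occur.\<close>

lemma integral_by_parts_cube:
  fixes u :: "'a::euclidean_space \<Rightarrow> 'b::banach" and \<psi> :: "'a \<Rightarrow> real"
  assumes u: "\<And>z. z \<in> cube 3 \<Longrightarrow> (u has_derivative blinfun_apply (u' z)) (at z)"
    and u': "continuous_on (cube 3) u'"
    and \<psi>: "\<And>z. (\<psi> has_derivative blinfun_apply (\<psi>' z)) (at z)"
    and \<psi>': "continuous_on UNIV \<psi>'"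
    and supp: "\<And>z. z \<notin> cube 1 \<Longrightarrow> \<psi> z = 0"
  shows "integral (cube 2) (\<lambda>z. \<psi> z *\<^sub>R u' z a) = - integral (cube 2) (\<lambda>z. \<psi>' z a *\<^sub>R u z)"
proof -
  \<comment> \<open>For \<open>s\<close> between \<open>-e\<close> and \<open>e\<close> the vector
    \<open>s *\<^sub>R a\<close> lies in \<open>cube 1\<close>, so \<open>z + s *\<^sub>R a\<close>
    stays in \<open>cube 3\<close>, where \<open>u\<close> is differentiable.\<close>
  define e where "e = 1 / (1 + norm a)"
  have e: "e > 0" by (simp add: e_def add_pos_nonneg)
  have sa: "s *\<^sub>R a \<in> cube 1" if "s \<in> {-e..e}" for s
  proof (rule norm_le_imp_mem_cube)
    have "\<bar>s\<bar> * norm a \<le> e * (1 + norm a)" using that by (intro mult_mono) auto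
    also have "\<dots> = 1" unfolding e_def by (smt (verit) norm_ge_zero nonzero_divide_eq_eq)
    finally show "norm (s *\<^sub>R a) \<le> 1" by simp
  qed
  have in3: "z + s *\<^sub>R a \<in> cube 3" if "s \<in> {-e..e}" "z \<in> cube 2" for s z
    using cube_add[OF that(2) sa[OF that(1)]] by simp
  have cu: "continuous_on (cube 3) u"
    using u by (meson has_derivative_at_withinI has_derivative_continuous_on)
  have c\<psi>: "continuous_on UNIV \<psi>"
    using \<psi> by (meson has_derivative_at_withinI has_derivative_continuous_on)
  have 1: "((\<lambda>s. integral (cube 2) (\<lambda>z. \<psi> z *\<^sub>R u (z + s *\<^sub>R a))) has_vector_derivative
      integral (cube 2) (\<lambda>z. \<psi> z *\<^sub>R u' (z + 0 *\<^sub>R a) a)) (at 0 within {-e..e})"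
    unfolding cube_def[of 2]
  proof (rule leibniz_rule_vector_derivative, unfold cube_def[symmetric])
    fix s z assume sz: "s \<in> {-e..e}" "z \<in> (cube 2 :: 'a set)"
    have "((\<lambda>s. u (z + s *\<^sub>R a)) has_derivative (\<lambda>h. u' (z + s *\<^sub>R a) (h *\<^sub>R a))) (at s within {-e..e})"
      by (rule has_derivative_compose[where g = u and f = "\<lambda>s. z + s *\<^sub>R a" and x = s, OF _ u[OF in3[OF sz]]]) (auto intro!: derivative_eq_intros)
    then show "((\<lambda>s. \<psi> z *\<^sub>R u (z + s *\<^sub>R a)) has_vector_derivative \<psi> z *\<^sub>R u' (z + s *\<^sub>R a) a) (at s within {-e..e})"
      unfolding has_vector_derivative_def
      by (auto intro!: derivative_eq_intros simp: blinfun.bilinear_simps)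
  next
    fix s assume s: "s \<in> {-e..e}"
    show "(\<lambda>z. \<psi> z *\<^sub>R u (z + s *\<^sub>R a)) integrable_on cube 2"
      unfolding cube_def
      by (intro integrable_continuous continuous_intros continuous_on_subset[OF c\<psi>]
          continuous_on_compose2[OF cu]) (use s in3 in \<open>auto simp: cube_def\<close>)
  next
    show "continuous_on ({-e..e} \<times> cube 2) (\<lambda>(s, z). \<psi> z *\<^sub>R u' (z + s *\<^sub>R a) a)"
      unfolding split_beta
      by (intro continuous_intros continuous_on_compose2[OF c\<psi>] continuous_on_compose2[OF u'])
         (use in3 in auto)
  qed (use e in auto)
  have 2: "((\<lambda>s. integral (cube 2) (\<lambda>z. \<psi> (z - s *\<^sub>R a) *\<^sub>R u z)) has_vector_derivative
      integral (cube 2) (\<lambda>z. - \<psi>' (z - 0 *\<^sub>R a) a *\<^sub>R u z)) (at 0 within {-e..e})"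
    unfolding cube_def[of 2]
  proof (rule leibniz_rule_vector_derivative, unfold cube_def[symmetric])
    fix s z assume sz: "s \<in> {-e..e}" "z \<in> (cube 2 :: 'a set)"
    have "((\<lambda>s. \<psi> (z - s *\<^sub>R a)) has_derivative (\<lambda>h. \<psi>' (z - s *\<^sub>R a) (- (h *\<^sub>R a)))) (at s within {-e..e})"
      by (rule has_derivative_compose[where g = \<psi> and f = "\<lambda>s. z - s *\<^sub>R a" and x = s, OF _ \<psi>]) (auto intro!: derivative_eq_intros)
    then show "((\<lambda>s. \<psi> (z - s *\<^sub>R a) *\<^sub>R u z) has_vector_derivative - \<psi>' (z - s *\<^sub>R a) a *\<^sub>R u z) (at s within {-e..e})"
      unfolding has_vector_derivative_def
      by (auto intro!: derivative_eq_intros simp: blinfun.bilinear_simps)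
  next
    fix s assume s: "s \<in> {-e..e}"
    show "(\<lambda>z. \<psi> (z - s *\<^sub>R a) *\<^sub>R u z) integrable_on cube 2"
      unfolding cube_def
      by (intro integrable_continuous continuous_intros continuous_on_subset[OF cu]
          continuous_on_compose2[OF c\<psi>]) (use cube_mono[of 2 3] in \<open>auto simp: cube_def\<close>)
  next
    show "continuous_on ({-e..e} \<times> cube 2) (\<lambda>(s, z). - \<psi>' (z - s *\<^sub>R a) a *\<^sub>R u z)"
      unfolding split_beta
      by (intro continuous_intros continuous_on_compose2[OF cu] continuous_on_compose2[OF \<psi>'])
         (use cube_mono[of 2 3] in auto)
  qed (use e in auto)
  have eq: "integral (cube 2) (\<lambda>z. \<psi> (z - s *\<^sub>R a) *\<^sub>R u z) =
      integral (cube 2) (\<lambda>z. \<psi> z *\<^sub>R u (z + s *\<^sub>R a))" if s: "s \<in> {-e..e}" for s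
  proof -
    have "(\<lambda>z. \<psi> z *\<^sub>R u (z + s *\<^sub>R a)) integrable_on cube 2"
      unfolding cube_def
      by (intro integrable_continuous continuous_intros continuous_on_subset[OF c\<psi>]
          continuous_on_compose2[OF cu]) (use s in3 in \<open>auto simp: cube_def\<close>)
    from has_integral_shift_support[OF integrable_integral[OF this] _ sa[OF s]] supp
    show ?thesis by (intro integral_unique) simp
  qed
  have "integral (cube 2) (\<lambda>z. \<psi> z *\<^sub>R u' (z + 0 *\<^sub>R a) a) = integral (cube 2) (\<lambda>z. - \<psi>' (z - 0 *\<^sub>R a) a *\<^sub>R u z)"
  proof (rule vector_derivative_unique_within)
    show "at 0 within {-e..e} \<noteq> bot"
      using e by (simp add: trivial_limit_within)
    show "((\<lambda>s. integral (cube 2) (\<lambda>z. \<psi> z *\<^sub>R u (z + s *\<^sub>R a))) has_vector_derivative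
        integral (cube 2) (\<lambda>z. - \<psi>' (z - 0 *\<^sub>R a) a *\<^sub>R u z)) (at 0 within {-e..e})"
      using 2 by (rule has_vector_derivative_transform[rotated 2]) (use e eq in auto)
  qed (rule 1)
  then show ?thesis by simp
qed

lemma integrable_on_cube:
  fixes f :: "'a::euclidean_space \<Rightarrow> 'b::banach"
  shows "continuous_on (cube r) f \<Longrightarrow> f integrable_on cube r"
  unfolding cube_def by (rule integrable_continuous)

text \<open>Both sides are an integration by parts away from an expression symmetric in \<open>a\<close> and \<open>b\<close>,
  because the bump is radial.\<close>

lemma integral_bump_rotation:
  fixes u :: "'a::euclidean_space \<Rightarrow> 'b::banach"
  assumes u: "\<And>z. z \<in> cube 3 \<Longrightarrow> (u has_derivative blinfun_apply (u' z)) (at z)"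
    and u': "continuous_on (cube 3) u'"
  shows "integral (cube 2) (\<lambda>z. (bump (Suc (Suc k)) z * (z \<bullet> b)) *\<^sub>R u' z a) =
    integral (cube 2) (\<lambda>z. (bump (Suc (Suc k)) z * (z \<bullet> a)) *\<^sub>R u' z b)"
proof -
  define D where "D c z = bump (Suc (Suc k)) z *\<^sub>R blinfun_inner_right c +
     (z \<bullet> c) *\<^sub>R ((- 2 * real (k + 2) * bump (Suc k) z) *\<^sub>R blinfun_inner_right z)" for c z :: 'a
  have 1: "integral (cube 2) (\<lambda>z. (bump (Suc (Suc k)) z * (z \<bullet> c)) *\<^sub>R u' z a) =
      - integral (cube 2) (\<lambda>z. D c z a *\<^sub>R u z)" for c a
  proof (rule integral_by_parts_cube[OF u u'])
    show "((\<lambda>z. bump (Suc (Suc k)) z * (z \<bullet> c)) has_derivative blinfun_apply (D c z)) (at z)" for z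
      by (rule derivative_eq_intros bump_has_derivative refl)+
         (auto simp: D_def fun_eq_iff blinfun.bilinear_simps blinfun_inner_right.rep_eq inner_commute algebra_simps)
    show "continuous_on UNIV (D c)"
      unfolding D_def by (intro continuous_intros)
    show "bump (Suc (Suc k)) z * (z \<bullet> c) = 0" if "z \<notin> cube 1" for z
      using bump_eq_0[OF that] by simp
  qed
  have "D b z a = D a z b" for z
    by (simp add: D_def blinfun.bilinear_simps blinfun_inner_right.rep_eq inner_commute algebra_simps)
  then show ?thesis by (simp add: 1)
qed

section \<open>Means over small cubes and second derivatives\<close>

text \<open>The Leibniz rule is applied to integrals of bounded linear maps, which are evaluated at
  \<open>v\<close> afterwards. It needs \<open>U\<close> convex; openness of \<open>U\<close> then
  turns the derivative within \<open>U\<close> into a full one.\<close>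

lemma integral_cube_has_derivative:
  fixes F :: "'a::euclidean_space \<Rightarrow> 'b::banach" and p :: "'a \<Rightarrow> real"
  assumes F: "\<And>x. x \<in> S \<Longrightarrow> (F has_derivative blinfun_apply (F' x)) (at x)"
    and F': "continuous_on S F'"
    and p: "continuous_on (cube 2) p"
    and U: "open U" "convex U" "x \<in> U"
    and sub: "\<And>y z. y \<in> U \<Longrightarrow> z \<in> cube 2 \<Longrightarrow> y + d *\<^sub>R z \<in> S"
  shows "((\<lambda>y. integral (cube 2) (\<lambda>z. p z *\<^sub>R F (y + d *\<^sub>R z))) has_derivative
     (\<lambda>v. integral (cube 2) (\<lambda>z. p z *\<^sub>R F' (x + d *\<^sub>R z) v))) (at x)"
proof -
  have cF: "continuous_on S F"
    using F by (meson has_derivative_at_withinI has_derivative_continuous_on)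
  have "((\<lambda>y. integral (cube 2) (\<lambda>z. p z *\<^sub>R F (y + d *\<^sub>R z))) has_derivative
     blinfun_apply (integral (cube 2) (\<lambda>z. p z *\<^sub>R F' (x + d *\<^sub>R z)))) (at x within U)"
    unfolding cube_def[of 2]
  proof (rule leibniz_rule, unfold cube_def[symmetric])
    fix y z assume yz: "y \<in> U" "z \<in> (cube 2 :: 'a set)"
    have "((\<lambda>y. F (y + d *\<^sub>R z)) has_derivative F' (y + d *\<^sub>R z)) (at y within U)"
      by (rule has_derivative_compose[where g = F and f = "\<lambda>y. y + d *\<^sub>R z" and x = y and f' = "\<lambda>h. h",
            OF _ F[OF sub[OF yz]]]) (auto intro!: derivative_eq_intros)
    then show "((\<lambda>y. p z *\<^sub>R F (y + d *\<^sub>R z)) has_derivative (p z *\<^sub>R F' (y + d *\<^sub>R z))) (at y within U)"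
      by (auto intro!: derivative_eq_intros simp: blinfun.bilinear_simps)
  next
    fix y assume y: "y \<in> U"
    show "(\<lambda>z. p z *\<^sub>R F (y + d *\<^sub>R z)) integrable_on cube 2"
      by (intro integrable_on_cube continuous_intros p continuous_on_compose2[OF cF])
         (use y sub in auto)
  next
    show "continuous_on (U \<times> cube 2) (\<lambda>(y, z). p z *\<^sub>R F' (y + d *\<^sub>R z))"
      unfolding split_beta
      by (intro continuous_intros continuous_on_compose2[OF p] continuous_on_compose2[OF F'])
         (use sub in auto)
  qed (use U in auto)
  moreover have "blinfun_apply (integral (cube 2) (\<lambda>z. p z *\<^sub>R F' (x + d *\<^sub>R z))) =
      (\<lambda>v. integral (cube 2) (\<lambda>z. p z *\<^sub>R F' (x + d *\<^sub>R z) v))"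
  proof -
    have "(\<lambda>z. p z *\<^sub>R F' (x + d *\<^sub>R z)) integrable_on cube 2"
      by (intro integrable_on_cube continuous_intros p continuous_on_compose2[OF F'])
         (use U sub in auto)
    from blinfun_apply_integral[OF this] show ?thesis
      by (simp add: fun_eq_iff blinfun.bilinear_simps)
  qed
  ultimately show ?thesis
    using at_within_open[OF U(3,1)] by simp
qed

text \<open>A nonnegative continuous function with zero integral vanishes, whereas
  \<open>bump k 0\<close> is 1.\<close>

lemma integral_bump_pos: "integral (cube 2) (bump k :: 'a::euclidean_space \<Rightarrow> real) > 0"
proof (rule ccontr)
  assume neg: "\<not> ?thesis"
  have int: "(bump k :: 'a \<Rightarrow> real) integrable_on cube 2"
    by (intro integrable_on_cube continuous_intros)
  have "integral (cube 2) (bump k :: 'a \<Rightarrow> real) \<ge> 0"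
    by (rule integral_nonneg[OF int]) (simp add: bump_def)
  with neg int have "((bump k :: 'a \<Rightarrow> real) has_integral 0) (cube 2)"
    by (metis integrable_integral linorder_not_less nle_le)
  then have "bump k (0::'a) = 0"
    unfolding cube_def
    by (rule has_integral_0_cbox_imp_0[rotated 2])
       (auto intro!: continuous_intros simp: bump_def box_ne_empty mem_box)
  then show False by (simp add: bump_def)
qed

text \<open>The hypothesis says that the weighted mean of \<open>F\<close> over the ball of radius \<open>\<delta>\<close> does not depend on
  \<open>\<delta>\<close>; so \<open>F\<close> equals its means, and all derivatives can be moved to the weight.\<close>

lemma second_derivative_of_mean_value:
  fixes F :: "'a::euclidean_space \<Rightarrow> 'b::banach"
  assumes F: "\<And>x. x \<in> S \<Longrightarrow> (F has_derivative blinfun_apply (F' x)) (at x)"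
    and F': "continuous_on S F'"
    and S: "open S"
    and mean: "\<And>x \<delta>. \<delta> > 0 \<Longrightarrow> (\<And>z. z \<in> cube 3 \<Longrightarrow> x + \<delta> *\<^sub>R z \<in> S) \<Longrightarrow>
       integral (cube 2) (\<lambda>z. bump 3 z *\<^sub>R F' (x + \<delta> *\<^sub>R z) z) = 0"
    and x0: "x0 \<in> S"
  obtains H where "\<And>v. ((\<lambda>x. F' x v) has_derivative (\<lambda>w. H w v)) (at x0)" "\<And>v w. H v w = H w v"
proof -
  from S x0 obtain r where r: "r > 0" "ball x0 r \<subseteq> S" by (meson openE)
  define U where "U = ball x0 (r / 2)"
  define M where "M = 3 * real DIM('a)"
  have M: "M > 0" by (simp add: M_def)
  \<comment> \<open>Vectors of \<open>cube 3\<close> have norm at most \<open>M\<close>, so a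
    displacement by \<open>t *\<^sub>R z\<close> with \<open>t\<close> at most \<open>d\<close> has
    length at most \<open>r / 4\<close>. It cannot lead from \<open>U\<close> out of the ball of
    radius \<open>r\<close>.\<close>
  define d where "d = r / (4 * M)"
  have d: "d > 0" using r M by (simp add: d_def)
  have cF: "continuous_on S F"
    using F by (meson has_derivative_at_withinI has_derivative_continuous_on)
  have sub3: "y + t *\<^sub>R z \<in> S" if "y \<in> U" "z \<in> cube 3" "t \<in> {0..d}" for y z t
  proof -
    have "norm z \<le> M" using norm_le_of_mem_cube[OF that(2)] by (simp add: M_def)
    then have "norm (t *\<^sub>R z) \<le> d * M" using that d M by (auto intro!: mult_mono)
    also have "\<dots> < r / 2" using r M by (simp add: d_def field_simps)
    finally have "norm (t *\<^sub>R z) < r / 2" .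
    moreover have "dist x0 y < r / 2" using that by (simp add: U_def)
    moreover have "dist x0 (y + t *\<^sub>R z) \<le> dist x0 y + norm (t *\<^sub>R z)"
      by (metis add_diff_cancel_left' dist_commute dist_norm dist_triangle)
    ultimately have "y + t *\<^sub>R z \<in> ball x0 r" by simp
    then show ?thesis using r by blast
  qed
  have sub2: "y + t *\<^sub>R z \<in> S" if "y \<in> U" "z \<in> cube 2" "t \<in> {0..d}" for y z t
    using sub3 that cube_mono[of 2 3] by auto
  have US: "U \<subseteq> S" using r by (auto simp: U_def)
  have x0U: "x0 \<in> U" using r by (simp add: U_def)
  define c where "c = integral (cube 2) (bump 3 :: 'a \<Rightarrow> real)"
  have c: "c > 0" unfolding c_def by (rule integral_bump_pos)
  have mv: "integral (cube 2) (\<lambda>z. bump 3 z *\<^sub>R F (x + d *\<^sub>R z)) = c *\<^sub>R F x" if x: "x \<in> U" for x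
  proof -
    define G where "G t = integral (cube 2) (\<lambda>z. bump 3 z *\<^sub>R F (x + t *\<^sub>R z))" for t
    have G': "(G has_vector_derivative integral (cube 2) (\<lambda>z. bump 3 z *\<^sub>R F' (x + t *\<^sub>R z) z)) (at t within {0..d})"
      if t: "t \<in> {0..d}" for t
      unfolding cube_def[of 2] G_def
    proof (rule leibniz_rule_vector_derivative, unfold cube_def[symmetric])
      fix s z assume sz: "s \<in> {0..d}" "z \<in> (cube 2 :: 'a set)"
      have "((\<lambda>s. F (x + s *\<^sub>R z)) has_derivative (\<lambda>h. F' (x + s *\<^sub>R z) (h *\<^sub>R z))) (at s within {0..d})"
        by (rule has_derivative_compose[where g = F and f = "\<lambda>s. x + s *\<^sub>R z" and x = s,
              OF _ F[OF sub2[OF x sz(2,1)]]]) (auto intro!: derivative_eq_intros)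
      then show "((\<lambda>s. bump 3 z *\<^sub>R F (x + s *\<^sub>R z)) has_vector_derivative bump 3 z *\<^sub>R F' (x + s *\<^sub>R z) z) (at s within {0..d})"
        unfolding has_vector_derivative_def
        by (auto intro!: derivative_eq_intros simp: blinfun.bilinear_simps)
    next
      fix s assume s: "s \<in> {0..d}"
      show "(\<lambda>z. bump 3 z *\<^sub>R F (x + s *\<^sub>R z)) integrable_on cube 2"
        by (intro integrable_on_cube continuous_intros continuous_on_compose2[OF cF])
           (use s x sub2 in auto)
    next
      have cb: "continuous_on UNIV (bump 3 :: 'a \<Rightarrow> real)" by (intro continuous_intros)
      show "continuous_on ({0..d} \<times> cube 2) (\<lambda>(s, z). bump 3 z *\<^sub>R F' (x + s *\<^sub>R z) z)"
        unfolding split_beta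
        by (intro continuous_intros continuous_on_compose2[OF cb] continuous_on_compose2[OF F'])
           (use x sub2 in auto)
    qed (use t in auto)
    \<comment> \<open>The radius 0 is an exceptional point, as \<open>mean\<close> speaks of
      positive radii only; continuity of \<open>G\<close> there is enough.\<close>
    have "G d = G 0"
    proof (rule has_derivative_zero_unique_strong_interval[of "{0}" 0 d G "G 0" d])
      show "continuous_on {0..d} G"
        using G' has_vector_derivative_continuous continuous_on_eq_continuous_within by blast
      show "(G has_derivative (\<lambda>h. 0)) (at t within {0..d})" if "t \<in> {0..d} - {0}" for t
      proof -
        have "integral (cube 2) (\<lambda>z. bump 3 z *\<^sub>R F' (x + t *\<^sub>R z) z) = 0"
          using that x by (intro mean sub3) auto
        then show ?thesis using G'[of t] that by (auto simp: has_vector_derivative_def)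
      qed
    qed (use d in auto)
    moreover have "G 0 = c *\<^sub>R F x"
      unfolding G_def c_def
      using integral_linear[of "bump 3 :: 'a \<Rightarrow> real" "cube 2" "\<lambda>s. s *\<^sub>R F x"]
      by (simp add: o_def integrable_on_cube continuous_on_bump bounded_linear_scaleR_left)
    ultimately show ?thesis by (simp add: G_def)
  qed
  have U: "open U" "convex U" by (auto simp: U_def)
  have sub2d: "y + d *\<^sub>R z \<in> S" if "y \<in> U" "z \<in> cube 2" for y z
    using sub2[OF that, of d] d by simp
  \<comment> \<open>The factor 6 comes from the gradient of \<open>bump 3\<close>, \<open>d\<close>
    from the rescaling of the argument, and \<open>c\<close> is the total mass of the
    weight.\<close>
  define K where "K = 6 / (d * c)"
  have scaled: "((\<lambda>z. F (x + d *\<^sub>R z)) has_derivative blinfun_apply (d *\<^sub>R F' (x + d *\<^sub>R z))) (at z)"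
    if "x \<in> U" "z \<in> cube 3" for x z
  proof -
    have "x + d *\<^sub>R z \<in> S" using sub3[OF that, of d] d by simp
    then have "((\<lambda>z. F (x + d *\<^sub>R z)) has_derivative (\<lambda>h. F' (x + d *\<^sub>R z) (d *\<^sub>R h))) (at z)"
      by (intro has_derivative_compose[where g = F and f = "\<lambda>z. x + d *\<^sub>R z" and x = z, OF _ F])
         (auto intro!: derivative_eq_intros)
    moreover have "(\<lambda>h. F' (x + d *\<^sub>R z) (d *\<^sub>R h)) = blinfun_apply (d *\<^sub>R F' (x + d *\<^sub>R z))"
      by (simp add: fun_eq_iff blinfun.bilinear_simps)
    ultimately show ?thesis by (simp only:)
  qed
  have scaled': "continuous_on (cube 3) (\<lambda>z. d *\<^sub>R F' (x + d *\<^sub>R z))" if "x \<in> U" for x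
    by (intro continuous_intros continuous_on_compose2[OF F']) (use that sub3 d in auto)
  \<comment> \<open>The right side contains \<open>F\<close> but not its derivative, so it can be
    differentiated once more under the integral sign.\<close>
  have first: "F' x v = K *\<^sub>R integral (cube 2) (\<lambda>z. (bump 2 z * (z \<bullet> v)) *\<^sub>R F (x + d *\<^sub>R z))"
    if x: "x \<in> U" for x v
  proof -
    have "((\<lambda>y. c *\<^sub>R F y) has_derivative
       (\<lambda>v. integral (cube 2) (\<lambda>z. bump 3 z *\<^sub>R F' (x + d *\<^sub>R z) v))) (at x)"
      by (rule has_derivative_transform_within_open[OF
            integral_cube_has_derivative[OF F F' continuous_on_bump U x sub2d] U(1) x mv])
    moreover have "((\<lambda>y. c *\<^sub>R F y) has_derivative (\<lambda>v. c *\<^sub>R F' x v)) (at x)"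
      using F[of x] x US by (auto intro!: derivative_eq_intros)
    ultimately have "(\<lambda>v. c *\<^sub>R F' x v) = (\<lambda>v. integral (cube 2) (\<lambda>z. bump 3 z *\<^sub>R F' (x + d *\<^sub>R z) v))"
      using has_derivative_unique by blast
    then have cF': "c *\<^sub>R F' x v = integral (cube 2) (\<lambda>z. bump 3 z *\<^sub>R F' (x + d *\<^sub>R z) v)"
      by metis
    have "d *\<^sub>R integral (cube 2) (\<lambda>z. bump 3 z *\<^sub>R F' (x + d *\<^sub>R z) v) =
        integral (cube 2) (\<lambda>z. bump 3 z *\<^sub>R (d *\<^sub>R F' (x + d *\<^sub>R z)) v)"
      by (simp add: blinfun.bilinear_simps mult.commute flip: integral_cmul)
    also have "\<dots> = - integral (cube 2) (\<lambda>z. ((- 2 * real (Suc 0 + 2) * bump (Suc (Suc 0)) z) *\<^sub>R blinfun_inner_right z) v *\<^sub>R F (x + d *\<^sub>R z))"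
    proof (rule integral_by_parts_cube[OF scaled[OF x] scaled'[OF x]])
      show "(bump 3 has_derivative blinfun_apply ((- 2 * real (Suc 0 + 2) * bump (Suc (Suc 0)) z) *\<^sub>R blinfun_inner_right z)) (at z)" for z :: 'a
        using bump_has_derivative[of "Suc 0" z] by (simp add: numeral_3_eq_3)
      show "continuous_on UNIV (\<lambda>z::'a. (- 2 * real (Suc 0 + 2) * bump (Suc (Suc 0)) z) *\<^sub>R blinfun_inner_right z)"
        by (intro continuous_intros)
      show "bump 3 z = 0" if "z \<notin> cube 1" for z :: 'a
        using bump_eq_0[OF that, of 2] by (simp add: numeral_3_eq_3)
    qed
    also have "\<dots> = 6 *\<^sub>R integral (cube 2) (\<lambda>z. (bump 2 z * (z \<bullet> v)) *\<^sub>R F (x + d *\<^sub>R z))"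
      by (simp add: blinfun.bilinear_simps blinfun_inner_right.rep_eq numeral_2_eq_2 mult.assoc flip: integral_cmul)
    finally have "(d * c) *\<^sub>R F' x v = 6 *\<^sub>R integral (cube 2) (\<lambda>z. (bump 2 z * (z \<bullet> v)) *\<^sub>R F (x + d *\<^sub>R z))"
      by (simp add: cF' flip: scaleR_scaleR)
    then have "(1 / (d * c)) *\<^sub>R (d * c) *\<^sub>R F' x v = K *\<^sub>R integral (cube 2) (\<lambda>z. (bump 2 z * (z \<bullet> v)) *\<^sub>R F (x + d *\<^sub>R z))"
      by (simp only: K_def) (simp)
    then show ?thesis using d c by simp
  qed
  \<comment> \<open>This is the derivative of the formula \<open>first\<close> in the direction
    \<open>w\<close>. Its symmetry is \<open>integral_bump_rotation\<close> for the weight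
    \<open>bump 2\<close>.\<close>
  define H where "H w v = K *\<^sub>R integral (cube 2) (\<lambda>z. (bump 2 z * (z \<bullet> v)) *\<^sub>R F' (x0 + d *\<^sub>R z) w)" for w v
  show thesis
  proof (rule that[of H])
    fix v
    have "((\<lambda>y. integral (cube 2) (\<lambda>z. (bump 2 z * (z \<bullet> v)) *\<^sub>R F (y + d *\<^sub>R z))) has_derivative
        (\<lambda>w. integral (cube 2) (\<lambda>z. (bump 2 z * (z \<bullet> v)) *\<^sub>R F' (x0 + d *\<^sub>R z) w))) (at x0)"
      by (rule integral_cube_has_derivative[OF F F' _ U x0U sub2d]) (auto intro!: continuous_intros)
    then have "((\<lambda>y. K *\<^sub>R integral (cube 2) (\<lambda>z. (bump 2 z * (z \<bullet> v)) *\<^sub>R F (y + d *\<^sub>R z))) has_derivative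
        (\<lambda>w. H w v)) (at x0)"
      unfolding H_def by (auto intro!: derivative_eq_intros)
    then show "((\<lambda>x. F' x v) has_derivative (\<lambda>w. H w v)) (at x0)"
      by (rule has_derivative_transform_within_open[OF _ U(1) x0U]) (simp add: first)
  next
    fix v w
    have "d *\<^sub>R integral (cube 2) (\<lambda>z. (bump 2 z * (z \<bullet> v)) *\<^sub>R F' (x0 + d *\<^sub>R z) w) =
        d *\<^sub>R integral (cube 2) (\<lambda>z. (bump 2 z * (z \<bullet> w)) *\<^sub>R F' (x0 + d *\<^sub>R z) v)"
      using integral_bump_rotation[OF scaled[OF x0U] scaled'[OF x0U], of 0 v w]
      by (simp add: blinfun.bilinear_simps numeral_2_eq_2 mult.commute flip: integral_cmul)
    then show "H v w = H w v" using d by (simp add: H_def)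
  qed
qed

section \<open>Cauchy-Fueter functions of several quaternionic variables\<close>

text \<open>Add the rows multiplied from the left by the conjugate units.\<close>

lemma quat_rows_zero:
  fixes A :: "4 \<Rightarrow> 4 \<Rightarrow> quat"
  assumes "\<And>c. A c 1 + qi \<otimes>\<^sub>q A c 2 + qj \<otimes>\<^sub>q A c 3 + qk \<otimes>\<^sub>q A c 4 = 0"
  shows "(\<Sum>c\<in>UNIV. A c c) + qi \<otimes>\<^sub>q (A 1 2 - A 2 1 - (A 3 4 - A 4 3)) +
     qj \<otimes>\<^sub>q (A 1 3 - A 3 1 + (A 2 4 - A 4 2)) + qk \<otimes>\<^sub>q (A 1 4 - A 4 1 - (A 2 3 - A 3 2)) = 0"
  using assms[of 1] assms[of 2] assms[of 3] assms[of 4]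
  unfolding sum_4 vec_eq_iff forall_4 qmult_def qi_def qj_def qk_def
  by simp

lemma bounded_linear_qmult: "bounded_linear (\<lambda>q. p \<otimes>\<^sub>q q)"
  by (rule linear_conv_bounded_linear[THEN iffD1], rule linearI)
     (simp_all add: vec_eq_iff forall_4 qmult_def algebra_simps)

lemma qmult_scaleR_right: "p \<otimes>\<^sub>q (r *\<^sub>R q) = r *\<^sub>R (p \<otimes>\<^sub>q q)"
  using linear_cmul[OF bounded_linear.linear[OF bounded_linear_qmult]] by blast

lemma qmult_zero_right [simp]: "p \<otimes>\<^sub>q 0 = 0"
  by (simp add: vec_eq_iff forall_4 qmult_def)

text \<open>Multiplied by the weight and by \<open>z \<bullet> e c\<close> and integrated, the
  Cauchy-Fueter equation becomes row \<open>c\<close> of a matrix \<open>A\<close>. This matrix is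
  symmetric by \<open>integral_bump_rotation\<close>, so in \<open>quat_rows_zero\<close> the
  differences cancel and only the trace survives.\<close>

lemma integral_bump_Fueter:
  fixes u :: "'a::euclidean_space \<Rightarrow> quat" and e :: "4 \<Rightarrow> 'a"
  assumes u: "\<And>z. z \<in> cube 3 \<Longrightarrow> (u has_derivative blinfun_apply (u' z)) (at z)"
    and u': "continuous_on (cube 3) u'"
    and Fueter: "\<And>z. z \<in> cube 3 \<Longrightarrow>
      u' z (e 1) + qi \<otimes>\<^sub>q u' z (e 2) + qj \<otimes>\<^sub>q u' z (e 3) + qk \<otimes>\<^sub>q u' z (e 4) = 0"
  shows "integral (cube 2) (\<lambda>z. bump 3 z *\<^sub>R (\<Sum>c\<in>UNIV. (z \<bullet> e c) *\<^sub>R u' z (e c))) = 0"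
proof -
  define g where "g c a z = (bump 3 z * (z \<bullet> e c)) *\<^sub>R u' z (e a)" for c a :: 4 and z
  define A where "A c a = integral (cube 2) (g c a)" for c a
  have int: "g c a integrable_on cube 2" for c a
    unfolding g_def
    by (intro integrable_on_cube continuous_intros continuous_on_subset[OF u'] cube_mono) auto
  have sym: "A c a = A a c" for a c
    unfolding A_def g_def
    using integral_bump_rotation[OF u u', of "Suc 0"] by (simp add: numeral_3_eq_3)
  have lin: "p \<otimes>\<^sub>q A c a = integral (cube 2) (\<lambda>z. p \<otimes>\<^sub>q g c a z)" for p c a
    unfolding A_def
    using integral_linear[OF int bounded_linear_qmult, of p c a] by (simp add: o_def)
  have int': "(\<lambda>z. p \<otimes>\<^sub>q g c a z) integrable_on cube 2" for p c a
    using integrable_linear[OF int bounded_linear_qmult, of p c a] by (simp add: o_def)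
  have row: "A c 1 + qi \<otimes>\<^sub>q A c 2 + qj \<otimes>\<^sub>q A c 3 + qk \<otimes>\<^sub>q A c 4 = 0" for c
  proof -
    have "A c 1 + qi \<otimes>\<^sub>q A c 2 + qj \<otimes>\<^sub>q A c 3 + qk \<otimes>\<^sub>q A c 4 =
        integral (cube 2) (\<lambda>z. g c 1 z + qi \<otimes>\<^sub>q g c 2 z + qj \<otimes>\<^sub>q g c 3 z + qk \<otimes>\<^sub>q g c 4 z)"
      unfolding lin unfolding A_def
      by (simp add: integral_add integrable_add int int')
    also have "\<dots> = integral (cube 2) (\<lambda>z::'a. 0)"
    proof (rule integral_cong)
      fix z :: 'a assume "z \<in> cube 2"
      then have "z \<in> cube 3" using cube_mono[of 2 3] by auto
      have "g c 1 z + qi \<otimes>\<^sub>q g c 2 z + qj \<otimes>\<^sub>q g c 3 z + qk \<otimes>\<^sub>q g c 4 z =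
          (bump 3 z * (z \<bullet> e c)) *\<^sub>R (u' z (e 1) + qi \<otimes>\<^sub>q u' z (e 2) + qj \<otimes>\<^sub>q u' z (e 3) + qk \<otimes>\<^sub>q u' z (e 4))"
        unfolding g_def
        by (simp add: qmult_scaleR_right scaleR_add_right)
      then show "g c 1 z + qi \<otimes>\<^sub>q g c 2 z + qj \<otimes>\<^sub>q g c 3 z + qk \<otimes>\<^sub>q g c 4 z = 0"
        using Fueter[OF \<open>z \<in> cube 3\<close>] by simp
    qed
    finally show ?thesis by simp
  qed
  have "(\<Sum>c\<in>UNIV. A c c) = 0"
    using quat_rows_zero[of A, OF row] sym[of 1 2] sym[of 1 3] sym[of 1 4] sym[of 2 3] sym[of 2 4] sym[of 3 4]
    by simp
  moreover have "(\<Sum>c\<in>UNIV. A c c) = integral (cube 2) (\<lambda>z. \<Sum>c\<in>UNIV. g c c z)"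
    unfolding A_def by (rule integral_sum[symmetric]) (auto intro: int)
  ultimately show ?thesis by (simp add: g_def scaleR_sum_right)
qed

text \<open>The expansion splits the radial derivative \<open>u' z z\<close> into blocks of four
  directions, one for each quaternionic variable, and \<open>integral_bump_Fueter\<close>
  annihilates each block. This is the hypothesis on means.\<close>

lemma Fueter_second_derivative:
  fixes F :: "'a::euclidean_space \<Rightarrow> quat" and e :: "'i::finite \<Rightarrow> 4 \<Rightarrow> 'a"
  assumes e: "\<And>z. z = (\<Sum>i\<in>UNIV. \<Sum>c\<in>UNIV. (z \<bullet> e i c) *\<^sub>R e i c)"
    and F: "\<And>x. x \<in> S \<Longrightarrow> (F has_derivative blinfun_apply (F' x)) (at x)"
    and F': "continuous_on S F'"
    and S: "open S"
    and Fueter: "\<And>x i. x \<in> S \<Longrightarrow>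
      F' x (e i 1) + qi \<otimes>\<^sub>q F' x (e i 2) + qj \<otimes>\<^sub>q F' x (e i 3) + qk \<otimes>\<^sub>q F' x (e i 4) = 0"
    and x0: "x0 \<in> S"
  obtains H where "\<And>v. ((\<lambda>x. F' x v) has_derivative (\<lambda>w. H w v)) (at x0)" "\<And>v w. H v w = H w v"
proof (rule second_derivative_of_mean_value[OF F F' S _ x0])
  fix x \<delta> assume \<delta>: "(\<delta>::real) > 0" and sub: "\<And>z. z \<in> cube 3 \<Longrightarrow> x + \<delta> *\<^sub>R z \<in> S"
  define u' where "u' z = \<delta> *\<^sub>R F' (x + \<delta> *\<^sub>R z)" for z
  have u: "((\<lambda>z. F (x + \<delta> *\<^sub>R z)) has_derivative blinfun_apply (u' z)) (at z)" if "z \<in> cube 3" for z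
  proof -
    have "((\<lambda>z. F (x + \<delta> *\<^sub>R z)) has_derivative (\<lambda>h. F' (x + \<delta> *\<^sub>R z) (\<delta> *\<^sub>R h))) (at z)"
      by (intro has_derivative_compose[where g = F and f = "\<lambda>z. x + \<delta> *\<^sub>R z" and x = z, OF _ F[OF sub[OF that]]])
         (auto intro!: derivative_eq_intros)
    moreover have "(\<lambda>h. F' (x + \<delta> *\<^sub>R z) (\<delta> *\<^sub>R h)) = blinfun_apply (u' z)"
      by (simp add: fun_eq_iff blinfun.bilinear_simps u'_def)
    ultimately show ?thesis by (simp only:)
  qed
  have u': "continuous_on (cube 3) u'"
    unfolding u'_def by (intro continuous_intros continuous_on_compose2[OF F']) (use sub in auto)
  have zero: "integral (cube 2) (\<lambda>z. bump 3 z *\<^sub>R (\<Sum>c\<in>UNIV. (z \<bullet> e i c) *\<^sub>R u' z (e i c))) = 0" for i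
  proof (rule integral_bump_Fueter[OF u u'])
    fix z :: 'a assume "z \<in> cube 3"
    have "u' z (e i 1) + qi \<otimes>\<^sub>q u' z (e i 2) + qj \<otimes>\<^sub>q u' z (e i 3) + qk \<otimes>\<^sub>q u' z (e i 4) =
      \<delta> *\<^sub>R (F' (x + \<delta> *\<^sub>R z) (e i 1) + qi \<otimes>\<^sub>q F' (x + \<delta> *\<^sub>R z) (e i 2) +
         qj \<otimes>\<^sub>q F' (x + \<delta> *\<^sub>R z) (e i 3) + qk \<otimes>\<^sub>q F' (x + \<delta> *\<^sub>R z) (e i 4))"
      by (simp add: u'_def blinfun.bilinear_simps qmult_scaleR_right scaleR_add_right)
    then show "u' z (e i 1) + qi \<otimes>\<^sub>q u' z (e i 2) + qj \<otimes>\<^sub>q u' z (e i 3) + qk \<otimes>\<^sub>q u' z (e i 4) = 0"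
      using Fueter[OF sub[OF \<open>z \<in> cube 3\<close>]] by simp
  qed
  have "u' z z = (\<Sum>i\<in>UNIV. \<Sum>c\<in>UNIV. (z \<bullet> e i c) *\<^sub>R u' z (e i c))" for z
  proof -
    have "u' z z = u' z (\<Sum>i\<in>UNIV. \<Sum>c\<in>UNIV. (z \<bullet> e i c) *\<^sub>R e i c)" using e[of z] by simp
    then show ?thesis by (simp add: blinfun.bilinear_simps)
  qed
  then have "integral (cube 2) (\<lambda>z. bump 3 z *\<^sub>R u' z z) =
      integral (cube 2) (\<lambda>z. \<Sum>i\<in>UNIV. bump 3 z *\<^sub>R (\<Sum>c\<in>UNIV. (z \<bullet> e i c) *\<^sub>R u' z (e i c)))"
    by (simp add: scaleR_sum_right)
  also have "\<dots> = (\<Sum>i\<in>UNIV. integral (cube 2) (\<lambda>z. bump 3 z *\<^sub>R (\<Sum>c\<in>UNIV. (z \<bullet> e i c) *\<^sub>R u' z (e i c))))"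
    by (rule integral_sum)
       (auto intro!: integrable_on_cube continuous_intros continuous_on_subset[OF u'] cube_mono)
  also have "\<dots> = 0" by (simp only: zero sum.neutral_const)
  finally have "\<delta> *\<^sub>R integral (cube 2) (\<lambda>z. bump 3 z *\<^sub>R F' (x + \<delta> *\<^sub>R z) z) = 0"
    by (simp add: u'_def blinfun.bilinear_simps mult.commute flip: integral_cmul)
  then show "integral (cube 2) (\<lambda>z. bump 3 z *\<^sub>R F' (x + \<delta> *\<^sub>R z) z) = 0"
    using \<delta> by simp
qed (assumption, rule that)

section \<open>From the group to quaternionic coordinates and back\<close>

text \<open>The standard basis grouped by quaternionic variable: \<open>None\<close> is the variable
  formed by \<open>t\<close> and the three central coordinates, \<open>Some l\<close> is the block
  \<open>l\<close>.\<close>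

fun Fueter_frame :: "'m::finite option \<Rightarrow> 4 \<Rightarrow> real \<times> 'm heis" where
  "Fueter_frame None c = (if c = 1 then (1, 0, 0) else (0, axis (if c = 2 then 1 else if c = 3 then 2 else 3) 1, 0))"
| "Fueter_frame (Some l) c = (0, 0, axis l (axis c 1))"

lemma Fueter_frame_expansion:
  "z = (\<Sum>i\<in>UNIV. \<Sum>c\<in>UNIV. (z \<bullet> Fueter_frame i c) *\<^sub>R Fueter_frame i c)"
proof -
  obtain t tv y where z: "z = (t, tv, y)" by (metis prod_cases3)
  have None: "(\<Sum>c\<in>UNIV. (z \<bullet> Fueter_frame None c) *\<^sub>R Fueter_frame None c) = (t, tv, 0)"
    by (simp add: sum_4 z inner_axis zero_prod_def) (simp add: vec_eq_iff forall_3 axis_def)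
  have Some: "(\<Sum>l\<in>UNIV. \<Sum>c\<in>UNIV. (z \<bullet> Fueter_frame (Some l) c) *\<^sub>R Fueter_frame (Some l) c) = (0, 0, y)"
  proof -
    have "(\<Sum>l\<in>UNIV. \<Sum>c\<in>UNIV. (y $ l $ c) *\<^sub>R axis l (axis c 1)) $ l' $ c' = y $ l' $ c'" for l' c'
    proof -
      have "(\<Sum>l\<in>UNIV. \<Sum>c\<in>UNIV. (y $ l $ c) *\<^sub>R axis l (axis c (1::real))) $ l' $ c' =
          (\<Sum>l\<in>UNIV. if l = l' then (\<Sum>c\<in>UNIV. if c = c' then y $ l $ c else 0) else 0)"
        unfolding sum_component by (intro sum.cong refl) (auto simp: axis_def if_distrib[of "(*) _"] cong: if_cong)
      then show ?thesis by simp
    qed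
    then have "(\<Sum>l\<in>UNIV. \<Sum>c\<in>UNIV. (y $ l $ c) *\<^sub>R axis l (axis c 1)) = y"
      by (simp add: vec_eq_iff)
    then show ?thesis by (simp add: z inner_axis prod_eq_iff fst_sum snd_sum)
  qed
  show ?thesis
    unfolding UNIV_option_conv by (simp add: sum.reindex None Some del: Fueter_frame.simps) (simp add: z)
qed

lemma dir_deriv_eq:
  assumes "(f has_derivative f') (at p)"
  shows "dir_deriv v f p = f' v"
proof -
  have "((\<lambda>s::real. f (p + s *\<^sub>R v)) has_derivative (\<lambda>s. f' (s *\<^sub>R v))) (at 0)"
    by (rule has_derivative_compose[where g = f and f = "\<lambda>s. p + s *\<^sub>R v" and x = 0])
       (use assms in \<open>auto intro!: derivative_eq_intros\<close>)
  then have "((\<lambda>s::real. f (p + s *\<^sub>R v)) has_vector_derivative f' v) (at 0)"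
    using linear_cmul[OF has_derivative_linear[OF assms]] by (simp add: has_vector_derivative_def)
  then show ?thesis unfolding dir_deriv_def by (rule vector_derivative_at)
qed

text \<open>\<open>f \<circ> shear (- 1)\<close> is the paper's \<open>f \<circ> \<pi>\<close>.\<close>

definition shear :: "real \<Rightarrow> real \<times> 'm::finite heis \<Rightarrow> real \<times> 'm heis" where
  "shear s p = (fst p + s * (snd (snd p) \<bullet> snd (snd p)), snd p)"

definition shear' :: "real \<Rightarrow> real \<times> 'm::finite heis \<Rightarrow> real \<times> 'm heis \<Rightarrow> real \<times> 'm heis" where
  "shear' s p v = v + (2 * s * (snd (snd p) \<bullet> snd (snd v))) *\<^sub>R (1, 0, 0)"

lemma shear_has_derivative:
  fixes p :: "real \<times> 'm::finite heis"
  shows "(shear s has_derivative shear' s p) (at p)"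
proof -
  have "((\<lambda>p. p + (s * (snd (snd p) \<bullet> snd (snd p))) *\<^sub>R (1, 0, 0)) has_derivative shear' s p) (at p)"
    unfolding shear'_def
    by (auto intro!: derivative_eq_intros simp: fun_eq_iff inner_commute algebra_simps)
  moreover have "shear s = (\<lambda>p :: real \<times> 'm heis. p + (s * (snd (snd p) \<bullet> snd (snd p))) *\<^sub>R (1, 0, 0))"
    by (simp add: shear_def fun_eq_iff prod_eq_iff)
  ultimately show ?thesis by (simp only:)
qed

lemma shear_inverse [simp]: "shear (- s) (shear s p) = p"
  by (simp add: shear_def)

lemma bounded_linear_shear': "bounded_linear (shear' s p)"
  using shear_has_derivative has_derivative_bounded_linear by blast

lemma open_upper_half: "open (upper_half :: (real \<times> 'm::finite heis) set)"
  unfolding upper_half_def by (intro open_Times) auto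

text \<open>Row \<open>k\<close> of \<open>bmat $ \<alpha>\<close>, read as a quaternion, is the
  \<open>k\<close>-th basis unit times the imaginary unit number \<open>\<alpha>\<close>. The
  matrices thus encode right multiplication by i, j, k, and \<open>y\<close> factors out on the
  left.\<close>

lemma quat_frame_identity:
  fixes y T :: quat and U :: "3 \<Rightarrow> quat"
  defines "D c \<equiv> y $ c *\<^sub>R T + (\<Sum>\<alpha>\<in>UNIV. \<Sum>k\<in>UNIV. (bmat $ \<alpha> $ k $ c * y $ k) *\<^sub>R U \<alpha>)"
  shows "D 1 + qi \<otimes>\<^sub>q D 2 + qj \<otimes>\<^sub>q D 3 + qk \<otimes>\<^sub>q D 4 =
    y \<otimes>\<^sub>q (T + qi \<otimes>\<^sub>q U 1 + qj \<otimes>\<^sub>q U 2 + qk \<otimes>\<^sub>q U 3)"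
  unfolding D_def bmat_def sum_3 sum_4 vec_eq_iff forall_4 qmult_def qi_def qj_def qk_def
  by (simp add: algebra_simps)

lemma Yfield_eq:
  assumes "(g has_derivative g') (at p)"
  shows "Yfield l c g p = g' (0, 0, axis l (axis c 1)) +
    2 *\<^sub>R (\<Sum>\<alpha>\<in>UNIV. \<Sum>k\<in>UNIV. (bmat $ \<alpha> $ k $ c * snd (snd p) $ l $ k) *\<^sub>R g' (0, axis \<alpha> 1, 0))"
  by (cases p) (use assms in \<open>simp add: Yfield_def d_y_def d_tvec_def dir_deriv_eq\<close>)

text \<open>For \<open>None\<close> the equation is \<open>Qbar0 f = 0\<close> itself. For
  \<open>Some l\<close> the shear changes \<open>Yfield l c f\<close> by
  \<open>- 2 *\<^sub>R E c\<close>; by \<open>quat_frame_identity\<close> the quaternionic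
  combination of the \<open>E c\<close> is \<open>y $ l\<close> times \<open>Qbar0 f\<close>, hence
  zero.\<close>

lemma regular_Fueter:
  fixes f :: "real \<times> 'm::finite heis \<Rightarrow> quat"
  assumes "regular f"
    and f': "\<And>p. p \<in> upper_half \<Longrightarrow> (f has_derivative blinfun_apply (f' p)) (at p)"
    and p: "shear (- 1) p \<in> upper_half"
  defines "F' v \<equiv> f' (shear (- 1) p) (shear' (- 1) p v)"
  shows "F' (Fueter_frame i 1) + qi \<otimes>\<^sub>q F' (Fueter_frame i 2) + qj \<otimes>\<^sub>q F' (Fueter_frame i 3) +
    qk \<otimes>\<^sub>q F' (Fueter_frame i 4) = 0"
proof -
  define P where "P = shear (- 1) p"
  have P: "P \<in> upper_half" using p by (simp add: P_def)
  define y where "y = snd (snd p)"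
  have Py: "snd (snd P) = y" by (simp add: P_def shear_def y_def)
  note dd = dir_deriv_eq[OF f'[OF P]]
  define T where "T = f' P (1, 0, 0)"
  define U where "U \<alpha> = f' P (0, axis \<alpha> 1, 0)" for \<alpha>
  define V where "V l c = f' P (0, 0, axis l (axis c 1))" for l c
  have Y: "Yfield l c f P = V l c + 2 *\<^sub>R (\<Sum>\<alpha>\<in>UNIV. \<Sum>k\<in>UNIV. (bmat $ \<alpha> $ k $ c * y $ l $ k) *\<^sub>R U \<alpha>)" for l c
    by (simp add: Yfield_eq[OF f'[OF P]] Py U_def V_def)
  have Q0: "T + qi \<otimes>\<^sub>q U 1 + qj \<otimes>\<^sub>q U 2 + qk \<otimes>\<^sub>q U 3 = 0"
    using \<open>regular f\<close> P dd by (auto simp: regular_def Qbar0_def d_t_def d_tvec_def T_def U_def)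
  have Q: "Yfield l 1 f P + qi \<otimes>\<^sub>q Yfield l 2 f P + qj \<otimes>\<^sub>q Yfield l 3 f P + qk \<otimes>\<^sub>q Yfield l 4 f P = 0" for l
    using \<open>regular f\<close> P by (simp add: regular_def Qbar_def)
  show ?thesis
  proof (cases i)
    case None
    then show ?thesis
      using Q0 by (simp add: F'_def P_def[symmetric] shear'_def T_def U_def)
  next
    case (Some l)
    define E where "E c = y $ l $ c *\<^sub>R T + (\<Sum>\<alpha>\<in>UNIV. \<Sum>k\<in>UNIV. (bmat $ \<alpha> $ k $ c * y $ l $ k) *\<^sub>R U \<alpha>)" for c
    have F'E: "F' (Fueter_frame (Some l) c) = Yfield l c f P - 2 *\<^sub>R E c" for c
    proof -
      have "F' (Fueter_frame (Some l) c) = f' P ((0, 0, axis l (axis c 1)) - (2 * y $ l $ c) *\<^sub>R (1, 0, 0))"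
        unfolding F'_def P_def[symmetric] by (simp add: shear'_def inner_axis y_def)
      then show ?thesis
        unfolding Y E_def by (simp only: blinfun.bilinear_simps V_def T_def) (simp add: algebra_simps)
    qed
    have "E 1 + qi \<otimes>\<^sub>q E 2 + qj \<otimes>\<^sub>q E 3 + qk \<otimes>\<^sub>q E 4 = 0"
      unfolding E_def using quat_frame_identity[of "y $ l" T U] Q0 by simp
    moreover have "p \<otimes>\<^sub>q (a - 2 *\<^sub>R b) = p \<otimes>\<^sub>q a - 2 *\<^sub>R (p \<otimes>\<^sub>q b)" for p a b
      by (simp add: vec_eq_iff forall_4 qmult_def algebra_simps)
    moreover have "a1 - 2 *\<^sub>R b1 + (a2 - 2 *\<^sub>R b2) + (a3 - 2 *\<^sub>R b3) + (a4 - 2 *\<^sub>R b4) =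
        (a1 + a2 + a3 + a4) - 2 *\<^sub>R (b1 + b2 + b3 + b4)" for a1 a2 a3 a4 b1 b2 b3 b4 :: quat
      by (simp add: algebra_simps)
    ultimately show ?thesis
      using Q[of l] unfolding Some F'E by (simp only: scaleR_zero_right diff_self)
  qed
qed

text \<open>The second derivative is obtained for the sheared function \<open>F\<close> and carried
  back along \<open>shear 1\<close> by the chain and product rules.\<close>

lemma regular_second_derivative:
  fixes f :: "real \<times> 'm::finite heis \<Rightarrow> quat"
  assumes "regular f"
    and f': "\<And>p. p \<in> upper_half \<Longrightarrow> (f has_derivative blinfun_apply (f' p)) (at p)"
    and cf': "continuous_on upper_half f'"
    and P: "P \<in> upper_half"
  obtains H where "\<And>v. ((\<lambda>p. f' p v) has_derivative (\<lambda>w. H w v)) (at P)" "\<And>v w. H v w = H w v"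
proof -
  \<comment> \<open>Explicitly, the set of points with \<open>t\<close> greater than the squared
    norm of \<open>y\<close>.\<close>
  define S :: "(real \<times> 'm heis) set" where "S = shear (- 1) -` upper_half"
  define F where "F p = f (shear (- 1) p)" for p
  define K :: "real \<times> 'm heis \<Rightarrow> (real \<times> 'm heis) \<Rightarrow>\<^sub>L (real \<times> 'm heis)"
    where "K p = Blinfun (shear' (- 1) p)" for p
  have K: "blinfun_apply (K p) = shear' (- 1) p" for p
    unfolding K_def by (rule bounded_linear_Blinfun_apply[OF bounded_linear_shear'])
  define F' where "F' p = f' (shear (- 1) p) o\<^sub>L K p" for p
  have F'_apply: "blinfun_apply (F' p) v = f' (shear (- 1) p) (shear' (- 1) p v)" for p v
    by (simp add: F'_def K)
  have cs: "continuous_on A (shear s)" for A :: "(real \<times> 'm heis) set" and s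
    unfolding shear_def[abs_def] by (intro continuous_intros)
  have "open S" unfolding S_def using open_upper_half cs by (metis continuous_on_open_vimage open_UNIV Int_UNIV_right)
  have cK: "continuous_on A K" for A
    by (rule continuous_on_blinfun_componentwise) (auto simp: K shear'_def intro!: continuous_intros)
  have cF': "continuous_on S F'"
    unfolding F'_def
    by (intro continuous_intros cK continuous_on_compose2[OF cf' cs]) (auto simp: S_def)
  have F: "(F has_derivative blinfun_apply (F' p)) (at p)" if "p \<in> S" for p
  proof -
    have "(F has_derivative (\<lambda>v. f' (shear (- 1) p) (shear' (- 1) p v))) (at p)"
      unfolding F_def
      by (rule has_derivative_compose[where g = f, OF shear_has_derivative f']) (use that in \<open>simp add: S_def\<close>)
    then show ?thesis by (simp add: F'_apply[symmetric])
  qed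
  have Pshear: "shear (- 1) (shear 1 p) = p" for p :: "real \<times> 'm heis"
    using shear_inverse[of 1 p] by simp
  have "shear 1 P \<in> S" using P by (simp add: S_def Pshear)
  have Fueter: "F' p (Fueter_frame i 1) + qi \<otimes>\<^sub>q F' p (Fueter_frame i 2) + qj \<otimes>\<^sub>q F' p (Fueter_frame i 3) +
    qk \<otimes>\<^sub>q F' p (Fueter_frame i 4) = 0" if "p \<in> S" for p i
    unfolding F'_apply by (rule regular_Fueter[OF \<open>regular f\<close> f']) (use that in \<open>auto simp: S_def\<close>)
  obtain H where H: "\<And>v. ((\<lambda>x. F' x v) has_derivative (\<lambda>w. H w v)) (at (shear 1 P))"
    and sym: "\<And>v w. H v w = H w v"
    using Fueter_second_derivative[OF Fueter_frame_expansion F cF' \<open>open S\<close> Fueter \<open>shear 1 P \<in> S\<close>] by blast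
  \<comment> \<open>A derivative is linear in its direction \<open>w\<close>; symmetry passes this
    on to the other argument.\<close>
  have linH: "linear (\<lambda>v. H w v)" for w
    using has_derivative_linear[OF H[of w]] sym by presburger
  define e0 :: "real \<times> 'm heis" where "e0 = (1, 0, 0)"
  \<comment> \<open>Here \<open>shear' 1 p v\<close> is written out, so that the only dependence on
    \<open>p\<close> besides the base point is a scalar factor linear in \<open>y\<close>.\<close>
  have f'_eq: "f' p v = F' (shear 1 p) v + (2 * (snd (snd p) \<bullet> snd (snd v))) *\<^sub>R F' (shear 1 p) e0" for p v
  proof -
    have "shear' (- 1) (shear 1 p) (v + (2 * (snd (snd p) \<bullet> snd (snd v))) *\<^sub>R e0) = v"
      by (simp add: shear'_def shear_def e0_def zero_prod_def)
    then have "f' p v = F' (shear 1 p) (v + (2 * (snd (snd p) \<bullet> snd (snd v))) *\<^sub>R e0)"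
      by (simp only: F'_apply Pshear)
    then show ?thesis by (simp add: blinfun.bilinear_simps)
  qed
  have HP: "((\<lambda>p. F' (shear 1 p) v) has_derivative (\<lambda>w. H (shear' 1 P w) v)) (at P)" for v
    by (rule has_derivative_compose[where g = "\<lambda>x. F' x v", OF shear_has_derivative H])
  \<comment> \<open>The pulled back second derivative of \<open>F\<close>, plus the second
    derivative of the squared norm of \<open>y\<close> times the derivative of \<open>F\<close>
    along \<open>e0\<close>. Both terms are symmetric.\<close>
  define G where "G w v = H (shear' 1 P w) (shear' 1 P v) +
     (2 * (snd (snd w) \<bullet> snd (snd v))) *\<^sub>R F' (shear 1 P) e0" for w v
  show thesis
  proof (rule that[of G])
    fix v
    have "H a (shear' 1 P v) = H a v + (2 * (snd (snd P) \<bullet> snd (snd v))) *\<^sub>R H a e0" for a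
      unfolding shear'_def e0_def[symmetric] linear_add[OF linH] linear_cmul[OF linH] by simp
    moreover have "((\<lambda>p. F' (shear 1 p) v + (2 * (snd (snd p) \<bullet> snd (snd v))) *\<^sub>R F' (shear 1 p) e0)
        has_derivative (\<lambda>w. H (shear' 1 P w) v +
          ((2 * (snd (snd P) \<bullet> snd (snd v))) *\<^sub>R H (shear' 1 P w) e0 +
           (2 * (snd (snd w) \<bullet> snd (snd v))) *\<^sub>R F' (shear 1 P) e0))) (at P)"
      by (intro has_derivative_add has_derivative_scaleR HP) (auto intro!: derivative_eq_intros)
    ultimately show "((\<lambda>p. f' p v) has_derivative (\<lambda>w. G w v)) (at P)"
      by (simp only: f'_eq G_def add.assoc)
  qed (simp add: G_def sym inner_commute)
qed

section \<open>Commutators of the fields and the sub-Laplacian\<close>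

text \<open>The field \<open>Yfield l c\<close> as a tangent vector at \<open>p\<close>, so that
  applying the field means evaluating a derivative in this direction.\<close>

definition Yvec :: "'m::finite \<Rightarrow> 4 \<Rightarrow> real \<times> 'm heis \<Rightarrow> real \<times> 'm heis" where
  "Yvec l c p = (0, 0, axis l (axis c 1)) +
    2 *\<^sub>R (\<Sum>\<alpha>\<in>UNIV. \<Sum>k\<in>UNIV. (bmat $ \<alpha> $ k $ c * snd (snd p) $ l $ k) *\<^sub>R (0, axis \<alpha> 1, 0))"

lemma linear_Yvec:
  assumes "linear g'"
  shows "g' (Yvec l c p) = g' (0, 0, axis l (axis c 1)) +
    2 *\<^sub>R (\<Sum>\<alpha>\<in>UNIV. \<Sum>k\<in>UNIV. (bmat $ \<alpha> $ k $ c * snd (snd p) $ l $ k) *\<^sub>R g' (0, axis \<alpha> 1, 0))"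
  unfolding Yvec_def linear_add[OF assms] linear_cmul[OF assms] linear_sum[OF assms] ..

lemma Yvec_y: "snd (snd (Yvec l c p)) = axis l (axis c 1)"
  by (simp add: Yvec_def snd_sum zero_prod_def)

text \<open>The rows of the matrix \<open>A\<close> of iterated fields are derivatives of the
  vanishing function \<open>Qbar l f\<close>, so \<open>quat_rows_zero\<close> applies again. This
  time the differences are commutators; they yield central derivatives, which
  \<open>Qbar0 f = 0\<close> converts into \<open>d_t f\<close>.\<close>

lemma sum_Yfield_Yfield:
  fixes f :: "real \<times> 'm::finite heis \<Rightarrow> quat"
  assumes "regular f" and P: "P \<in> upper_half"
  shows "(\<Sum>c\<in>UNIV. Yfield l c (Yfield l c f) P) = 8 *\<^sub>R d_t f P"
proof -
  obtain f' where f': "\<And>p. p \<in> upper_half \<Longrightarrow> (f has_derivative blinfun_apply (f' p)) (at p)"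
    and cf': "continuous_on upper_half f'"
    using \<open>regular f\<close> unfolding regular_def C1_on_def by blast
  obtain H where H: "\<And>v. ((\<lambda>p. f' p v) has_derivative (\<lambda>w. H w v)) (at P)" and sym: "\<And>v w. H v w = H w v"
    using regular_second_derivative[OF \<open>regular f\<close> f' cf' P] by blast
  have linH: "linear (\<lambda>v. H w v)" for w
    using has_derivative_linear[OF H[of w]] sym by presburger
  define U where "U \<alpha> = f' P (0, axis \<alpha> 1, 0)" for \<alpha>
  \<comment> \<open>Product rule: the second summand differentiates the coefficients of the field,
    which are linear in \<open>y\<close>. It is the source of the commutators.\<close>
  define Y' where "Y' c w = H w (Yvec l c P) +
     2 *\<^sub>R (\<Sum>\<alpha>\<in>UNIV. \<Sum>k\<in>UNIV. (bmat $ \<alpha> $ k $ c * snd (snd w) $ l $ k) *\<^sub>R U \<alpha>)" for c w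
  have Y: "(Yfield l c f has_derivative Y' c) (at P)" for c
  proof (rule has_derivative_transform_within_open[OF _ open_upper_half P])
    show "f' p (0, 0, axis l (axis c 1)) +
        2 *\<^sub>R (\<Sum>\<alpha>\<in>UNIV. \<Sum>k\<in>UNIV. (bmat $ \<alpha> $ k $ c * snd (snd p) $ l $ k) *\<^sub>R f' p (0, axis \<alpha> 1, 0)) = Yfield l c f p"
      if "p \<in> upper_half" for p
      using Yfield_eq[OF f'[OF that]] by simp
    show "((\<lambda>p. f' p (0, 0, axis l (axis c 1)) +
        2 *\<^sub>R (\<Sum>\<alpha>\<in>UNIV. \<Sum>k\<in>UNIV. (bmat $ \<alpha> $ k $ c * snd (snd p) $ l $ k) *\<^sub>R f' p (0, axis \<alpha> 1, 0)))
        has_derivative Y' c) (at P)"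
      unfolding Y'_def linear_Yvec[OF linH] U_def
      by (rule derivative_eq_intros H bounded_linear.has_derivative[OF bounded_linear_vec_nth] refl | simp)+
         (simp add: fun_eq_iff sum.distrib scaleR_add_right algebra_simps)
  qed
  define A where "A c a = Yfield l c (Yfield l a f) P" for c a
  have A: "A c a = Y' a (Yvec l c P)" for c a
    unfolding A_def Yfield_eq[OF Y] linear_Yvec[OF has_derivative_linear[OF Y]] ..
  have Q: "((\<lambda>p. Yfield l 1 f p + qi \<otimes>\<^sub>q Yfield l 2 f p + qj \<otimes>\<^sub>q Yfield l 3 f p + qk \<otimes>\<^sub>q Yfield l 4 f p)
      has_derivative (\<lambda>w. Y' 1 w + qi \<otimes>\<^sub>q Y' 2 w + qj \<otimes>\<^sub>q Y' 3 w + qk \<otimes>\<^sub>q Y' 4 w)) (at P)"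
    by (intro has_derivative_add Y bounded_linear.has_derivative[OF bounded_linear_qmult])
  have "((\<lambda>p. Yfield l 1 f p + qi \<otimes>\<^sub>q Yfield l 2 f p + qj \<otimes>\<^sub>q Yfield l 3 f p + qk \<otimes>\<^sub>q Yfield l 4 f p)
      has_derivative (\<lambda>w. 0)) (at P)"
    by (rule has_derivative_transform_within_open[OF has_derivative_const open_upper_half P])
       (use \<open>regular f\<close> in \<open>simp add: regular_def Qbar_def\<close>)
  \<comment> \<open>Evaluation of the zero derivative at \<open>Yvec l c P\<close> gives row
    \<open>c\<close>.\<close>
  from has_derivative_unique[OF Q this]
  have row: "A c 1 + qi \<otimes>\<^sub>q A c 2 + qj \<otimes>\<^sub>q A c 3 + qk \<otimes>\<^sub>q A c 4 = 0" for c
    unfolding A by metis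
  \<comment> \<open>The terms with \<open>H\<close> cancel by symmetry; only the derivatives of the
    coefficients remain.\<close>
  have comm: "A c a - A a c = 2 *\<^sub>R (\<Sum>\<alpha>\<in>UNIV. (bmat $ \<alpha> $ c $ a - bmat $ \<alpha> $ a $ c) *\<^sub>R U \<alpha>)" for c a
  proof -
    have "A c a = H (Yvec l c P) (Yvec l a P) + 2 *\<^sub>R (\<Sum>\<alpha>\<in>UNIV. (bmat $ \<alpha> $ c $ a) *\<^sub>R U \<alpha>)" for c a
    proof -
      have "(\<Sum>k\<in>UNIV. (bmat $ \<alpha> $ k $ a * (axis l (axis c 1) :: quat ^ 'm) $ l $ k) *\<^sub>R U \<alpha>) =
          (\<Sum>k\<in>UNIV. if k = c then (bmat $ \<alpha> $ k $ a) *\<^sub>R U \<alpha> else 0)" for \<alpha>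
        by (rule sum.cong) (auto simp: axis_def)
      then show ?thesis unfolding A Y'_def Yvec_y by simp
    qed
    then show ?thesis
      using sym[of "Yvec l c P" "Yvec l a P"]
      by (simp add: scaleR_diff_left sum_subtractf scaleR_diff_right)
  qed
  \<comment> \<open>The matrices are antisymmetric, so each commutator is four times a central
    derivative up to sign, and the signs are such that the two in each line add up to 8.\<close>
  have c12: "A 1 2 - A 2 1 - (A 3 4 - A 4 3) = 8 *\<^sub>R U 1"
    and c13: "A 1 3 - A 3 1 + (A 2 4 - A 4 2) = 8 *\<^sub>R U 2"
    and c14: "A 1 4 - A 4 1 - (A 2 3 - A 3 2) = 8 *\<^sub>R U 3"
    unfolding comm sum_3 by (simp_all add: bmat_def vec_eq_iff forall_4)
  have Q0: "d_t f P + qi \<otimes>\<^sub>q U 1 + qj \<otimes>\<^sub>q U 2 + qk \<otimes>\<^sub>q U 3 = 0"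
    using \<open>regular f\<close> P dir_deriv_eq[OF f'[OF P]] by (auto simp: regular_def Qbar0_def d_tvec_def U_def)
  have "(\<Sum>c\<in>UNIV. A c c) + 8 *\<^sub>R (qi \<otimes>\<^sub>q U 1 + qj \<otimes>\<^sub>q U 2 + qk \<otimes>\<^sub>q U 3) = 0"
    using quat_rows_zero[of A, OF row] unfolding c12 c13 c14 qmult_scaleR_right by (simp add: algebra_simps)
  moreover have "qi \<otimes>\<^sub>q U 1 + qj \<otimes>\<^sub>q U 2 + qk \<otimes>\<^sub>q U 3 = - d_t f P"
    using Q0 by (simp add: eq_neg_iff_add_eq_0 algebra_simps)
  ultimately show ?thesis by (simp add: A_def)
qed

theorem theorem1p4:
  fixes n :: nat
    and f :: "real \<times> 'm::finite heis \<Rightarrow> quat"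
  assumes "n \<ge> 2"
    and "CARD('m) = n - 1"
    and "regular f"
  shows "\<forall>p\<in>upper_half. d_t f p + (1 / (8 * (real n - 1))) *\<^sub>R sub_Laplacian f p = 0"
proof
  fix p :: "real \<times> 'm heis" assume p: "p \<in> upper_half"
  have "real CARD('m) = real n - 1" using assms by simp
  \<comment> \<open>Every block contributes the same \<open>8 *\<^sub>R d_t f p\<close>, and there
    are \<open>n - 1\<close> blocks.\<close>
  moreover have "sub_Laplacian f p = - (real CARD('m) *\<^sub>R 8 *\<^sub>R d_t f p)"
    unfolding sub_Laplacian_def sum_Yfield_Yfield[OF \<open>regular f\<close> p] sum_constant_scaleR ..
  moreover have "1 / (8 * (real n - 1)) * ((real n - 1) * 8) = 1" using \<open>n \<ge> 2\<close> by simp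
  ultimately show "d_t f p + (1 / (8 * (real n - 1))) *\<^sub>R sub_Laplacian f p = 0"
    by (simp only: scaleR_minus_right scaleR_scaleR scaleR_one add.right_inverse mult.assoc[symmetric])
qed

end
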